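(* Let $r\ge2$ be an integer. The exponential generating function of the labelled diagrams associated with $X^rD$ is $$G(z;u,v)=\exp\left(\frac{uv}{\left[1-(r-1)u^{r-1}z\right]^{1/(r-1)}}-uv\right).$$ For $r=2$ and $n\ge1$, the normal form of $(X^2D)^n$ is $$\mathfrak N\bigl((X^2D)^n\bigr)=\sum_{k=1}^{n}\binom{n-1}{k-1}\frac{n!}{k!}\,X^{n+k}D^k .$$ For $r\ge3$, one has $$\mathfrak N\bigl((X^rD)^n\bigr)=\sum_{k}\gamma_{n,k}\,X^{k+(r-1)n}D^k,\qquad \gamma_{n,k}=\frac{n!}{k!}\sum_{\ell=0}^k(-1)^{k-\ell}\binom{k}{\ell}\binom{n+\ell/(r-1)-1}{n}(r-1)^n .$$
   Context: The operators $X,D$ satisfy $DX-XD=1$, and $\mathfrak N(\mathfrak f)$ denotes the normal form of $\mathfrak f$, i.e. its unique expression as a linear combination of monomials $X^aD^b$ with all $X$'s to the left of all $D$'s. Labelled diagrams associated with $X^rD$: a labelled diagram of size $n$ has inner nodes (gates) labelled $1,\dots,n$, each having one input slot and $r$ ordered (distinguishable) output slots, together with a set of connections, each joining an output slot of a node $i$ to the input slot of a node $j$ with $i<j$, every slot being used at most once. Unconnected output slots are the outputs of the diagram, unconnected input slots its inputs. Then $G(z;u,v)=\sum_{n,a,b}c_{n,a,b}u^av^b\frac{z^n}{n!}$, where $c_{n,a,b}$ is the number of labelled diagrams of size $n$ with $a$ outputs and $b$ inputs. Identities are between formal power series in $z$. For a rational number $x$ and an integer $n\ge0$, $\binom{x}{n}=x(x-1)\cdots(x-n+1)/n!$.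 *)

theory Defs
  imports
    "HOL-Library.Poly_Mapping"
    "HOL-Computational_Algebra.Formal_Power_Series"
begin

section \<open>Labelled diagrams\<close>

text \<open>The output slots of a node \<open>i\<close> are the pairs \<open>(i, s)\<close> with \<open>1 \<le> s \<le> r\<close>; its only input
  slot is denoted by \<open>i\<close> itself. A diagram is its set of connections (output slot, input slot).\<close>

type_synonym diagram = "((nat \<times> nat) \<times> nat) set"

definition output_slots :: "nat \<Rightarrow> nat \<Rightarrow> (nat \<times> nat) set" where
  "output_slots r n = {1..n} \<times> {1..r}"

definition input_slots :: "nat \<Rightarrow> nat set" where
  "input_slots n = {1..n}"

definition labelled_diagram :: "nat \<Rightarrow> nat \<Rightarrow> diagram \<Rightarrow> bool" where
  "labelled_diagram r n C \<longleftrightarrow>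
     C \<subseteq> output_slots r n \<times> input_slots n \<and>
     (\<forall>i s j. ((i, s), j) \<in> C \<longrightarrow> i < j) \<and>
     inj_on fst C \<and> inj_on snd C"

definition outputs :: "nat \<Rightarrow> nat \<Rightarrow> diagram \<Rightarrow> (nat \<times> nat) set" where
  "outputs r n C = output_slots r n - fst ` C"

definition inputs :: "nat \<Rightarrow> diagram \<Rightarrow> nat set" where
  "inputs n C = input_slots n - snd ` C"

definition num_diagrams :: "nat \<Rightarrow> nat \<Rightarrow> nat \<Rightarrow> nat \<Rightarrow> nat" where
  "num_diagrams r n a b =
     card {C. labelled_diagram r n C \<and> card (outputs r n C) = a \<and> card (inputs n C) = b}"

text \<open>A power series in \<open>z\<close>. The markers \<open>u\<close> and \<open>v\<close> are arbitrary elements of an arbitrary field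
  of characteristic 0. The ranges of \<open>a\<close> and \<open>b\<close> lose nothing, as a diagram of size \<open>n\<close> has only
  \<open>r * n\<close> output slots and \<open>n\<close> input slots.\<close>

definition diagram_egf :: "nat \<Rightarrow> 'k \<Rightarrow> 'k \<Rightarrow> 'k::field_char_0 fps" where
  "diagram_egf r u v = Abs_fps (\<lambda>n.
     (\<Sum>a\<le>r * n. \<Sum>b\<le>n. of_nat (num_diagrams r n a b) * u ^ a * v ^ b) / fact n)"

text \<open>The power \<open>F\<^sup>c\<close> of a series with constant term 1, via \<open>(1 + z)\<^sup>c = \<Sum>n. (c gchoose n) z\<^sup>n\<close>.\<close>

definition fps_gpower :: "'k::field_char_0 fps \<Rightarrow> 'k \<Rightarrow> 'k fps" where
  "fps_gpower F c = (fps_binomial c oo (F - 1))"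


section \<open>Normal forms\<close>

text \<open>The free associative algebra on the letters \<open>X\<close> and \<open>D\<close>, as the monoid algebra over \<open>'k\<close> of
  the free monoid of words.\<close>

datatype letter = X_letter | D_letter

datatype word = Word "letter list"

instantiation word :: monoid_add
begin

definition zero_word :: word where
  "zero_word = Word []"

fun plus_word :: "word \<Rightarrow> word \<Rightarrow> word" where
  "plus_word (Word p) (Word q) = Word (p @ q)"

instance
proof
  fix a b c :: word
  show "a + b + c = a + (b + c)" by (cases a; cases b; cases c) simp
  show "0 + a = a" by (cases a) (simp add: zero_word_def)
  show "a + 0 = a" by (cases a) (simp add: zero_word_def)
qed

end

type_synonym 'k free_algebra = "word \<Rightarrow>\<^sub>0 'k"

definition X_gen :: "'k::field_char_0 free_algebra" where
  "X_gen = Poly_Mapping.single (Word [X_letter]) 1"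

definition D_gen :: "'k::field_char_0 free_algebra" where
  "D_gen = Poly_Mapping.single (Word [D_letter]) 1"

definition scalar :: "'k::field_char_0 \<Rightarrow> 'k free_algebra" where
  "scalar c = Poly_Mapping.single 0 c"

text \<open>The two-sided ideal generated by \<open>DX - XD - 1\<close>; the Weyl algebra is the quotient by it.\<close>

inductive_set weyl_ideal :: "'k::field_char_0 free_algebra set" where
  zero: "0 \<in> weyl_ideal"
| add: "f \<in> weyl_ideal \<Longrightarrow> f + p * (D_gen * X_gen - X_gen * D_gen - 1) * q \<in> weyl_ideal"

text \<open>Linear combinations of the monomials \<open>X\<^sup>a D\<^sup>b\<close>.\<close>

definition normally_ordered :: "'k::field_char_0 free_algebra \<Rightarrow> bool" where
  "normally_ordered g \<longleftrightarrow>
     (\<forall>w \<in> Poly_Mapping.keys g. \<exists>a b. w = Word (replicate a X_letter @ replicate b D_letter))"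

definition normal_form :: "'k::field_char_0 free_algebra \<Rightarrow> 'k free_algebra" where
  "normal_form f = (THE g. normally_ordered g \<and> f - g \<in> weyl_ideal)"

definition \<gamma> :: "nat \<Rightarrow> nat \<Rightarrow> nat \<Rightarrow> 'k::field_char_0" where
  "\<gamma> r n k = fact n / fact k *
     (\<Sum>l=0..k. (- 1) ^ (k - l) * of_nat (k choose l) *
        ((of_nat n + of_nat l / of_nat (r - 1) - 1) gchoose n) * of_nat (r - 1) ^ n)"

end

theory Submission
  imports Defs "HOL-Computational_Algebra.Polynomial"
begin

unbundle fps_syntax

text \<open>Put \<open>s = r - 1\<close>. All three claims come from one triangular array \<open>c(n, k)\<close> with
  \<open>c(0, k) = [k = 0]\<close> and \<open>c(n + 1, k) = c(n, k - 1) + (k + s n) c(n, k)\<close>.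

  A diagram of size \<open>n\<close> with \<open>k\<close> inputs has \<open>k + s n\<close> outputs, since every connection uses up one
  output slot and one input slot. The last node of a diagram feeds no other node; its input
  slot is free or attached to one of the \<open>k + s n\<close> outputs of the rest. So diagrams with \<open>k\<close> inputs
  are counted by \<open>c(n, k)\<close> (lemma \<open>card_diagrams_Suc\<close>).

  Multiplying \<open>X\<^bsup>k + s n\<^esup>D\<^sup>k\<close> on the left by \<open>X\<^sup>rD\<close> and moving \<open>D\<close> to the right through the power of \<open>X\<close>
  gives the same two terms, so the coefficients of \<open>(X\<^sup>rD)\<^sup>n\<close> in normal order are \<open>c(n, k)\<close> as well
  (lemma \<open>normal_monomial_step\<close>). That this expression is the normal form requires uniqueness: a
  normally ordered element of the ideal acts as 0 on polynomials, and the action by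
  multiplication and differentiation is faithful on normally ordered elements
  (lemma \<open>normally_ordered_action_0\<close>).

  The numbers \<open>\<gamma> r n k\<close> are the coefficients of \<open>x (x + s) \<cdots> (x + (n - 1) s)\<close> in the basis of falling
  factorials, from which the recurrence is immediate (lemma \<open>gamma_Suc\<close>). Finally, the explicit
  formula for \<open>\<gamma>\<close> as an alternating sum is what the expansion of \<open>exp (u v (B - 1))\<close> with
  \<open>B = (1 - s u\<^sup>s z)\<^sup>-\<^sup>1\<^sup>/\<^sup>s\<close> yields coefficientwise (lemma \<open>diagram_egf_eq_exp\<close>).\<close>

section \<open>The coefficients and their recurrence\<close>

text \<open>The scaled binomial coefficient is a rising product:
  \<open>n! (x/s + n - 1 choose n) s\<^sup>n = x (x + s) \<cdots> (x + (n - 1) s)\<close> with \<open>s = r - 1\<close>. So \<open>\<gamma> r n k\<close> is the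
  \<open>k\<close>-th finite difference at 0 of this polynomial in \<open>x\<close>, divided by \<open>k!\<close>; in other words, the
  numbers \<open>\<gamma> r n k\<close> are its coefficients in the basis of falling factorials.\<close>

lemma gamma_eq_pochhammer:
  fixes r n k :: nat
  assumes "r \<ge> 2"
  shows "(\<gamma> r n k :: 'k::field_char_0) =
    (\<Sum>l\<le>k. (- 1) ^ (k - l) * of_nat (k choose l) *
       (of_nat (r - 1) ^ n * pochhammer (of_nat l / of_nat (r - 1)) n)) / fact k"
  unfolding \<gamma>_def gbinomial_pochhammer' atLeast0AtMost
  by (simp add: sum_distrib_left sum_divide_distrib mult_ac)

lemma gamma_0:
  assumes "r \<ge> 2"
  shows "(\<gamma> r 0 k :: 'k::field_char_0) = (if k = 0 then 1 else 0)"
proof -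
  have "(\<Sum>l\<le>k. (- 1) ^ (k - l) * of_nat (k choose l) :: 'k) = (1 + (- 1)) ^ k"
    by (subst binomial_ring) (simp add: mult_ac)
  then show ?thesis
    using assms by (simp add: gamma_eq_pochhammer)
qed

lemma scaled_pochhammer_Suc:
  assumes "s > 0"
  shows "of_nat s ^ Suc n * pochhammer (of_nat l / of_nat s) (Suc n) =
    (of_nat l + of_nat (s * n)) * (of_nat s ^ n * pochhammer (of_nat l / of_nat s) n :: 'k::field_char_0)"
  using assms by (simp add: pochhammer_Suc field_simps)

text \<open>This is what multiplication by \<open>x\<close> does to a finite difference at 0: the difference of order
  \<open>k + 1\<close> of \<open>x f(x)\<close> is \<open>k + 1\<close> times the sum of the differences of orders \<open>k + 1\<close> and \<open>k\<close> of \<open>f\<close>.\<close>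

lemma times_binomial_Suc:
  "of_nat l * of_nat (Suc k choose l) =
    (of_nat (Suc k) * (of_nat (Suc k choose l) - of_nat (k choose l)) :: 'k::comm_ring_1)"
proof (cases l)
  case 0
  then show ?thesis by simp
next
  case (Suc m)
  have "Suc m * (Suc k choose Suc m) = Suc k * (k choose m)"
    by (rule Suc_times_binomial)
  then have "of_nat (Suc m) * of_nat (Suc k choose Suc m) = (of_nat (Suc k) * of_nat (k choose m) :: 'k)"
    by (metis of_nat_mult)
  then show ?thesis
    by (simp add: Suc del: of_nat_Suc)
qed

text \<open>Passing from \<open>n\<close> to \<open>n + 1\<close> multiplies the rising product by \<open>x + s n\<close>. On the falling
  factorials, \<open>x\<close> acts by \<open>x \<cdot> x\<^bsub>(k)\<^esub> = x\<^bsub>(k+1)\<^esub> + k x\<^bsub>(k)\<^esub>\<close>, which gives both terms.\<close>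

lemma gamma_Suc:
  assumes "r \<ge> 2"
  shows "(\<gamma> r (Suc n) k :: 'k::field_char_0) =
    (if k = 0 then 0 else \<gamma> r n (k - 1)) + of_nat (k + (r - 1) * n) * \<gamma> r n k"
proof -
  define Q :: "nat \<Rightarrow> nat \<Rightarrow> 'k"
    where "Q n l = of_nat (r - 1) ^ n * pochhammer (of_nat l / of_nat (r - 1)) n" for n l
  have Q_Suc: "Q (Suc n) l = (of_nat l + of_nat ((r - 1) * n)) * Q n l" for l
    unfolding Q_def using assms by (intro scaled_pochhammer_Suc) simp
  have G: "\<gamma> r n k = (\<Sum>l\<le>k. (- 1) ^ (k - l) * of_nat (k choose l) * Q n l) / fact k" for n k
    unfolding Q_def by (rule gamma_eq_pochhammer[OF assms])
  show ?thesis
  proof (cases k)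
    case 0
    then show ?thesis by (simp add: G Q_Suc)
  next
    case (Suc m)
    have pt: "(- 1) ^ (k - l) * of_nat (k choose l) * Q (Suc n) l =
        of_nat (k + (r - 1) * n) * ((- 1) ^ (k - l) * of_nat (k choose l) * Q n l)
        - of_nat k * ((- 1) ^ (k - l) * of_nat (m choose l) * Q n l)" for l
    proof -
      have "of_nat (k choose l) * Q (Suc n) l =
          (of_nat l * of_nat (k choose l) + of_nat ((r - 1) * n) * of_nat (k choose l)) * Q n l"
        by (simp add: Q_Suc algebra_simps)
      also have "of_nat l * of_nat (k choose l) =
          (of_nat k * (of_nat (k choose l) - of_nat (m choose l)) :: 'k)"
        unfolding Suc by (rule times_binomial_Suc)
      finally show ?thesis
        unfolding of_nat_add by (simp only: mult.assoc) (simp add: algebra_simps)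
    qed
    have sgn: "(\<Sum>l\<le>k. (- 1) ^ (k - l) * of_nat (m choose l) * Q n l) =
        - (\<Sum>l\<le>m. (- 1) ^ (m - l) * of_nat (m choose l) * Q n l)"
      by (simp add: Suc sum_negf[symmetric] Suc_diff_le)
    have "(\<gamma> r (Suc n) k :: 'k) = (of_nat (k + (r - 1) * n) *
        (\<Sum>l\<le>k. (- 1) ^ (k - l) * of_nat (k choose l) * Q n l)
        + of_nat k * (\<Sum>l\<le>m. (- 1) ^ (m - l) * of_nat (m choose l) * Q n l)) / fact k"
      unfolding G pt sum_subtractf sum_distrib_left[symmetric] sgn by simp
    also have "\<dots> = \<gamma> r n m + of_nat (k + (r - 1) * n) * \<gamma> r n k"
      by (simp add: G Suc add_divide_distrib del: of_nat_Suc sum.atMost_Suc of_nat_add)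
    finally show ?thesis by (simp add: Suc)
  qed
qed

lemma gamma_eq_0:
  assumes "r \<ge> 2" "n < k"
  shows "(\<gamma> r n k :: 'k::field_char_0) = 0"
  using assms(2)
  by (induction n arbitrary: k) (auto simp: gamma_0 gamma_Suc assms(1))

lemma Suc_times_binomial_Suc_plus:
  "of_nat (Suc j) * of_nat (n choose Suc j) + of_nat j * of_nat (n choose j) =
    (of_nat n * of_nat (n choose j) :: 'k::comm_ring_1)"
proof -
  have "Suc j * (n choose Suc j) + j * (n choose j) = n * (n choose j)"
    using Suc_times_binomial_eq[of n j] by (simp add: algebra_simps)
  then show ?thesis by (metis of_nat_add of_nat_mult)
qed

text \<open>For \<open>r = 2\<close> the numbers are the unsigned Lah numbers; the closed form satisfies the recurrence
  because of the identity in the preceding lemma.\<close>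

lemma gamma_2:
  assumes "n \<ge> 1"
  shows "(\<gamma> 2 n k :: 'k::field_char_0) =
    (if k = 0 then 0 else of_nat ((n - 1) choose (k - 1)) * (fact n / fact k))"
  using assms
proof (induction n arbitrary: k rule: nat_induct_at_least)
  case base
  show ?case
    by (cases k) (auto simp: gamma_Suc[of 2 0, simplified] gamma_0)
next
  case (Suc n)
  show ?case
  proof (cases k)
    case 0
    then show ?thesis by (simp add: gamma_Suc Suc.IH)
  next
    case k: (Suc m)
    have rec: "(\<gamma> 2 (Suc n) k :: 'k) = \<gamma> 2 n m + of_nat (k + n) * \<gamma> 2 n k"
      using k by (simp add: gamma_Suc)
    show ?thesis
    proof (cases m)
      case 0
      then show ?thesis unfolding rec Suc.IH using k by (simp add: algebra_simps)
    next
      case m: (Suc j)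
      obtain n' where n: "n = Suc n'" using \<open>n \<ge> 1\<close> by (cases n) auto
      define a b where "a = (of_nat (n' choose j) :: 'k)" and "b = (of_nat (n' choose Suc j) :: 'k)"
      have ab: "of_nat (Suc j) * b + of_nat j * a = of_nat n' * a"
        unfolding a_def b_def by (rule Suc_times_binomial_Suc_plus)
      have fk: "fact k = (of_nat k * fact m :: 'k)" using k by simp
      have "of_nat k * a + of_nat (k + n) * b = of_nat (Suc n) * (a + b)"
        using ab unfolding k m n by (simp add: algebra_simps)
      then have "of_nat (Suc n) * (a + b) * (fact n / fact k) =
          (of_nat k * a + of_nat (k + n) * b) * (fact n / fact k)"
        by simp
      also have "\<dots> = a * (fact n / fact m) + of_nat (k + n) * (b * (fact n / fact k))"
        unfolding fk using k by (simp add: field_simps del: of_nat_Suc)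
      also have "\<dots> = \<gamma> 2 (Suc n) k"
        unfolding rec Suc.IH using k m n by (simp add: a_def b_def)
      finally show ?thesis
        using k m n by (simp add: a_def b_def mult_ac del: of_nat_Suc)
    qed
  qed
qed

section \<open>Counting labelled diagrams\<close>

lemma diagram_finite:
  assumes "labelled_diagram r n C"
  shows "finite C"
proof (rule finite_subset)
  show "C \<subseteq> output_slots r n \<times> input_slots n"
    using assms by (simp add: labelled_diagram_def)
  show "finite (output_slots r n \<times> input_slots n)"
    by (simp add: output_slots_def input_slots_def)
qed

lemma finite_diagrams: "finite {C. labelled_diagram r n C}"
proof (rule finite_subset)
  show "{C. labelled_diagram r n C} \<subseteq> Pow (output_slots r n \<times> input_slots n)"
    by (auto simp: labelled_diagram_def)
  show "finite (Pow (output_slots r n \<times> input_slots n))"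
    by (simp add: output_slots_def input_slots_def)
qed

text \<open>Each connection consumes one output slot and one input slot, so the number of inputs
  determines the number of outputs: one marker is enough for the enumeration.\<close>

lemma card_outputs_inputs:
  assumes "labelled_diagram r n C" "r \<ge> 1"
  shows "card (outputs r n C) = card (inputs n C) + (r - 1) * n"
proof -
  have fin: "finite C" using assms(1) by (rule diagram_finite)
  have "fst ` C \<subseteq> output_slots r n" "snd ` C \<subseteq> input_slots n"
    and inj: "inj_on fst C" "inj_on snd C"
    using assms by (auto simp: labelled_diagram_def)
  then have "card (outputs r n C) = n * r - card C" "card (inputs n C) = n - card C"
    and "card C \<le> n"
    using fin card_mono[of "input_slots n" "snd ` C"]
    by (simp_all add: outputs_def inputs_def card_Diff_subset card_image)
       (simp_all add: output_slots_def input_slots_def)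
  moreover obtain s where "r = Suc s" using assms(2) by (cases r) auto
  ultimately show ?thesis
    by (auto simp: algebra_simps)
qed

text \<open>The node with the largest label cannot feed any other node. Removing it therefore leaves a
  diagram on the remaining nodes, and it is recovered by saying which free output, if any, its
  input slot is attached to.\<close>

lemma labelled_diagram_Suc:
  "labelled_diagram r (Suc n) C \<longleftrightarrow>
     labelled_diagram r n C \<or>
     (\<exists>C' p. labelled_diagram r n C' \<and> p \<in> outputs r n C' \<and> C = insert (p, Suc n) C')"
proof
  assume L: "labelled_diagram r (Suc n) C"
  define C' where "C' = {c \<in> C. snd c \<noteq> Suc n}"
  have sub: "C \<subseteq> output_slots r (Suc n) \<times> input_slots (Suc n)"
    and less: "\<And>i s j. ((i, s), j) \<in> C \<Longrightarrow> i < j"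
    and inj: "inj_on fst C" "inj_on snd C"
    using L unfolding labelled_diagram_def by blast+
  have C': "labelled_diagram r n C'"
    unfolding labelled_diagram_def
  proof (intro conjI)
    show "C' \<subseteq> output_slots r n \<times> input_slots n"
    proof
      fix c assume c: "c \<in> C'"
      obtain i s j where ijs: "c = ((i, s), j)" by (cases c; cases "fst c") simp
      have "c \<in> C" "j \<noteq> Suc n" using c ijs by (auto simp: C'_def)
      moreover have "c \<in> output_slots r (Suc n) \<times> input_slots (Suc n)"
        using sub \<open>c \<in> C\<close> by (rule subsetD)
      moreover have "i < j" using less \<open>c \<in> C\<close> ijs by simp
      ultimately show "c \<in> output_slots r n \<times> input_slots n"
        by (simp add: ijs output_slots_def input_slots_def)
    qed
    show "\<forall>i s j. ((i, s), j) \<in> C' \<longrightarrow> i < j"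
      using less unfolding C'_def by blast
    show "inj_on fst C'" "inj_on snd C'"
      by (rule inj_on_subset[OF inj(1)] inj_on_subset[OF inj(2)], force simp: C'_def)+
  qed
  show "labelled_diagram r n C \<or>
     (\<exists>C' p. labelled_diagram r n C' \<and> p \<in> outputs r n C' \<and> C = insert (p, Suc n) C')"
  proof (cases "\<exists>p. (p, Suc n) \<in> C")
    case False
    then have "C' = C" unfolding C'_def by force
    with C' show ?thesis by simp
  next
    case True
    then obtain p where p: "(p, Suc n) \<in> C" by blast
    have eq: "C = insert (p, Suc n) C'"
    proof -
      have "c = (p, Suc n)" if "c \<in> C" "snd c = Suc n" for c
        using inj_onD[OF inj(2), of c "(p, Suc n)"] that p by simp
      then have "C \<subseteq> insert (p, Suc n) C'" unfolding C'_def by blast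
      moreover have "insert (p, Suc n) C' \<subseteq> C" using p unfolding C'_def by blast
      ultimately show ?thesis by (rule subset_antisym)
    qed
    have "p \<notin> fst ` C'"
    proof
      assume "p \<in> fst ` C'"
      then obtain c where c: "c \<in> C" "fst c = p" "snd c \<noteq> Suc n" by (auto simp: C'_def)
      have "c = (p, Suc n)" using inj_onD[OF inj(1) _ c(1) p] c(2) by simp
      then show False using c(3) by simp
    qed
    moreover have "p \<in> output_slots r n"
      using subsetD[OF sub p] less[of "fst p" "snd p" "Suc n"] p
      by (cases p) (simp add: output_slots_def)
    ultimately have "p \<in> outputs r n C'" by (simp add: outputs_def)
    then show ?thesis using C' eq by blast
  qed
next
  assume cases: "labelled_diagram r n C \<or>
     (\<exists>C' p. labelled_diagram r n C' \<and> p \<in> outputs r n C' \<and> C = insert (p, Suc n) C')"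
  have mono: "output_slots r n \<times> input_slots n \<subseteq> output_slots r (Suc n) \<times> input_slots (Suc n)"
    by (auto simp: output_slots_def input_slots_def)
  have "labelled_diagram r (Suc n) C" if "labelled_diagram r n C"
    using that mono unfolding labelled_diagram_def by blast
  moreover have "labelled_diagram r (Suc n) (insert (p, Suc n) C')"
    if C': "labelled_diagram r n C'" and p: "p \<in> outputs r n C'" for C' p
  proof -
    have sub: "C' \<subseteq> output_slots r n \<times> input_slots n" using C' by (simp add: labelled_diagram_def)
    have new: "p \<notin> fst ` C'" "Suc n \<notin> snd ` C'"
      using p sub by (auto simp: outputs_def input_slots_def)
    have pn: "(p, Suc n) \<in> output_slots r (Suc n) \<times> input_slots (Suc n)" and "fst p < Suc n"
      using p by (auto simp: outputs_def output_slots_def input_slots_def)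
    show ?thesis
      unfolding labelled_diagram_def
    proof (intro conjI)
      show "insert (p, Suc n) C' \<subseteq> output_slots r (Suc n) \<times> input_slots (Suc n)"
        using pn sub mono by blast
      show "\<forall>i s j. ((i, s), j) \<in> insert (p, Suc n) C' \<longrightarrow> i < j"
        using C' \<open>fst p < Suc n\<close> unfolding labelled_diagram_def by fastforce
      show "inj_on fst (insert (p, Suc n) C')" "inj_on snd (insert (p, Suc n) C')"
        using C' new by (auto simp: labelled_diagram_def)
    qed
  qed
  ultimately show "labelled_diagram r (Suc n) C" using cases by (elim disjE exE conjE) simp_all
qed

definition diagrams_with_inputs :: "nat \<Rightarrow> nat \<Rightarrow> nat \<Rightarrow> diagram set" where
  "diagrams_with_inputs r n k = {C. labelled_diagram r n C \<and> card (inputs n C) = k}"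

lemma finite_diagrams_with_inputs: "finite (diagrams_with_inputs r n k)"
  using finite_diagrams[of r n] by (rule rev_finite_subset) (auto simp: diagrams_with_inputs_def)

lemma Suc_notin_connections:
  assumes "labelled_diagram r n C"
  shows "(p, Suc n) \<notin> C"
  using assms by (auto simp: labelled_diagram_def input_slots_def)

lemma inputs_Suc:
  assumes "labelled_diagram r n C"
  shows "inputs (Suc n) C = insert (Suc n) (inputs n C)"
    and "inputs (Suc n) (insert (p, Suc n) C) = inputs n C"
    and "card (insert (Suc n) (inputs n C)) = Suc (card (inputs n C))"
proof -
  have "Suc n \<notin> snd ` C" using Suc_notin_connections[OF assms] by auto
  then show "inputs (Suc n) C = insert (Suc n) (inputs n C)"
    and "inputs (Suc n) (insert (p, Suc n) C) = inputs n C"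
    by (auto simp: inputs_def input_slots_def)
  show "card (insert (Suc n) (inputs n C)) = Suc (card (inputs n C))"
    by (simp add: inputs_def input_slots_def)
qed

text \<open>A new last node either keeps its input slot free, which adds one input, or uses one of the
  \<open>k + (r - 1) n\<close> free outputs, which leaves the number of inputs unchanged.\<close>

lemma card_diagrams_Suc:
  assumes "r \<ge> 1"
  shows "card (diagrams_with_inputs r (Suc n) k) =
    (if k = 0 then 0 else card (diagrams_with_inputs r n (k - 1)))
    + (k + (r - 1) * n) * card (diagrams_with_inputs r n k)"
proof -
  \<comment> \<open>\<open>S\<close> and \<open>T\<close> collect the data for a connected and for an unconnected last node.\<close>
  define ext :: "diagram \<times> (nat \<times> nat) \<Rightarrow> diagram" where "ext = (\<lambda>(C, p). insert (p, Suc n) C)"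
  define S where "S = Sigma (diagrams_with_inputs r n k) (outputs r n)"
  define T where "T = {C. labelled_diagram r n C \<and> Suc (card (inputs n C)) = k}"
  have finT: "finite T"
    unfolding T_def using finite_diagrams[of r n] by (rule rev_finite_subset) auto
  have fino: "finite (outputs r n C)" for C
    by (simp add: outputs_def output_slots_def)
  have finS: "finite S"
    unfolding S_def by (intro finite_SigmaI finite_diagrams_with_inputs fino)
  have eq: "diagrams_with_inputs r (Suc n) k = T \<union> ext ` S"
    unfolding diagrams_with_inputs_def labelled_diagram_Suc S_def T_def ext_def
    by (auto simp: inputs_Suc image_iff)
  have disj: "T \<inter> ext ` S = {}"
    by (auto simp: T_def ext_def dest: Suc_notin_connections)
  have inj: "inj_on ext S"
  proof (rule inj_onI)
    fix x y assume x: "x \<in> S" and y: "y \<in> S" and e: "ext x = ext y"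
    obtain C p where xx: "x = (C, p)" by (cases x)
    obtain C' p' where yy: "y = (C', p')" by (cases y)
    have C: "(q, Suc n) \<notin> C" "(q, Suc n) \<notin> C'" for q
      using x y unfolding xx yy S_def diagrams_with_inputs_def
      by (auto dest: Suc_notin_connections)
    have "insert (p, Suc n) C = insert (p', Suc n) C'"
      using e by (simp add: xx yy ext_def)
    moreover from this C have "p = p'" by blast
    ultimately have "C = C'" using C by (simp add: insert_ident)
    with \<open>p = p'\<close> show "x = y" by (simp add: xx yy)
  qed
  have "card S = (\<Sum>C\<in>diagrams_with_inputs r n k. card (outputs r n C))"
    unfolding S_def by (intro card_SigmaI finite_diagrams_with_inputs ballI fino)
  also have "\<dots> = (\<Sum>C\<in>diagrams_with_inputs r n k. k + (r - 1) * n)"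
    using assms by (intro sum.cong refl)
      (auto simp: diagrams_with_inputs_def card_outputs_inputs simp del: One_nat_def)
  finally have "card S = (k + (r - 1) * n) * card (diagrams_with_inputs r n k)" by simp
  moreover have "card T = (if k = 0 then 0 else card (diagrams_with_inputs r n (k - 1)))"
    by (cases k) (auto simp: T_def diagrams_with_inputs_def)
  ultimately show ?thesis
    unfolding eq using finT finS disj inj by (simp add: card_Un_disjoint card_image)
qed

lemma card_diagrams_0: "card (diagrams_with_inputs r 0 k) = (if k = 0 then 1 else 0)"
proof -
  have "diagrams_with_inputs r 0 k = (if k = 0 then {{}} else {})"
    by (auto simp: diagrams_with_inputs_def labelled_diagram_def input_slots_def inputs_def)
  then show ?thesis by simp
qed

lemma card_diagrams_eq_gamma:
  assumes "r \<ge> 2"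
  shows "of_nat (card (diagrams_with_inputs r n k)) = (\<gamma> r n k :: 'k::field_char_0)"
proof (induction n arbitrary: k)
  case 0
  then show ?case using assms by (simp add: card_diagrams_0 gamma_0)
next
  case (Suc n)
  have "r \<ge> 1" using assms by simp
  then show ?case using Suc assms by (auto simp: card_diagrams_Suc gamma_Suc)
qed

lemma num_diagrams_eq:
  assumes "r \<ge> 1"
  shows "num_diagrams r n a b =
    (if a = b + (r - 1) * n then card (diagrams_with_inputs r n b) else 0)"
proof -
  have "{C. labelled_diagram r n C \<and> card (outputs r n C) = a \<and> card (inputs n C) = b} =
    (if a = b + (r - 1) * n then diagrams_with_inputs r n b else {})"
    using assms by (auto simp: diagrams_with_inputs_def card_outputs_inputs simp del: One_nat_def)
  then show ?thesis by (simp add: num_diagrams_def)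
qed

section \<open>The exponential generating function\<close>

lemma diagram_egf_nth:
  fixes u v :: "'k::field_char_0"
  assumes "r \<ge> 2"
  shows "diagram_egf r u v $ n =
    (\<Sum>k\<le>n. \<gamma> r n k * (u * v) ^ k) * (u ^ (r - 1)) ^ n / fact n"
proof -
  have "(\<Sum>a\<le>r * n. \<Sum>b\<le>n. of_nat (num_diagrams r n a b) * u ^ a * v ^ b) =
      (\<Sum>b\<le>n. \<Sum>a\<le>r * n. of_nat (num_diagrams r n a b) * u ^ a * v ^ b)"
    by (rule sum.swap)
  also have "\<dots> = (\<Sum>b\<le>n. \<gamma> r n b * (u * v) ^ b * (u ^ (r - 1)) ^ n)"
  proof (rule sum.cong)
    fix b assume "b \<in> {..n}"
    then have "b + (r - 1) * n \<le> n + (r - 1) * n" by simp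
    also have "\<dots> = r * n" using assms by (cases r) auto
    finally have le: "b + (r - 1) * n \<in> {..r * n}" by simp
    have "(\<Sum>a\<le>r * n. of_nat (num_diagrams r n a b) * u ^ a * v ^ b) =
        (\<Sum>a\<le>r * n. if a = b + (r - 1) * n then \<gamma> r n b * u ^ a * v ^ b else 0)"
      using assms by (intro sum.cong refl)
        (simp add: num_diagrams_eq card_diagrams_eq_gamma[symmetric])
    also have "\<dots> = \<gamma> r n b * u ^ (b + (r - 1) * n) * v ^ b"
      using le by (subst sum.delta) auto
    also have "\<dots> = \<gamma> r n b * (u * v) ^ b * (u ^ (r - 1)) ^ n"
      by (simp only: power_add power_mult power_mult_distrib) (simp only: mult_ac)
    finally show "(\<Sum>a\<le>r * n. of_nat (num_diagrams r n a b) * u ^ a * v ^ b) =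
        \<gamma> r n b * (u * v) ^ b * (u ^ (r - 1)) ^ n" .
  qed simp
  finally show ?thesis
    by (simp add: diagram_egf_def sum_distrib_right)
qed

lemma inverse_fps_gpower_power:
  fixes F :: "'k::field_char_0 fps"
  assumes "F $ 0 = 1"
  shows "inverse (fps_gpower F c) ^ l = fps_gpower F (- (of_nat l * c))"
proof -
  have z: "(F - 1) $ 0 = 0" using assms by simp
  have "fps_gpower F c * fps_gpower F (- c) = 1"
    unfolding fps_gpower_def fps_compose_mult_distrib[OF z, symmetric] fps_binomial_add_mult[symmetric]
    by simp
  then have "inverse (fps_gpower F c) = fps_gpower F (- c)"
    by (metis fps_inverse_unique)
  then show ?thesis
    unfolding fps_gpower_def by (simp add: fps_compose_power[OF z] fps_binomial_power)
qed

text \<open>The negative binomial series \<open>(1 - s a z)\<^sup>-\<^sup>l\<^sup>/\<^sup>s\<close>: up to the factors \<open>a\<^sup>n / n!\<close>, its coefficients are the rising products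
  whose finite differences in \<open>l\<close> are the numbers \<open>\<gamma>\<close>.\<close>

lemma inverse_fps_gpower_power_nth:
  fixes a :: "'k::field_char_0"
  shows "(inverse (fps_gpower (1 - fps_const (of_nat s * a) * fps_X) (1 / of_nat s)) ^ l) $ n =
    of_nat s ^ n * pochhammer (of_nat l / of_nat s) n * a ^ n / fact n"
proof -
  have "(inverse (fps_gpower (1 - fps_const (of_nat s * a) * fps_X) (1 / of_nat s)) ^ l) =
      fps_binomial (- (of_nat l / of_nat s)) oo (fps_const (- (of_nat s * a)) * fps_X)"
    by (subst inverse_fps_gpower_power) (simp_all add: fps_gpower_def flip: fps_const_neg)
  then show ?thesis
    by (simp add: fps_compose_linear gbinomial_pochhammer power_mult_distrib power_minus[of "of_nat s * a"])
qed

text \<open>With \<open>B = (1 - s u\<^sup>s z)\<^sup>-\<^sup>1\<^sup>/\<^sup>s\<close>, the right-hand side is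
  \<open>exp (u v (B - 1)) = \<Sum>k. (u v)\<^sup>k (B - 1)\<^sup>k / k!\<close>. Expanding \<open>(B - 1)\<^sup>k\<close> by the binomial theorem
  produces the alternating sum over \<open>l\<close> that defines \<open>\<gamma>\<close>.\<close>

lemma diagram_egf_eq_exp:
  fixes u v :: "'k::field_char_0"
  assumes "r \<ge> 2"
  shows "diagram_egf r u v =
       (fps_exp 1 oo
         (fps_const (u * v) /
            fps_gpower (1 - fps_const (of_nat (r - 1) * u ^ (r - 1)) * fps_X) (1 / of_nat (r - 1))
          - fps_const (u * v)))"
proof (rule fps_ext)
  fix n
  define g where "g = fps_gpower (1 - fps_const (of_nat (r - 1) * u ^ (r - 1)) * fps_X) (1 / of_nat (r - 1))"
  define B where "B = inverse g"
  have g0: "g $ 0 = 1" by (simp add: g_def fps_gpower_def)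
  have H: "fps_const (u * v) / g - fps_const (u * v) = fps_const (u * v) * (B - 1)"
    using g0 by (simp add: B_def fps_divide_unit algebra_simps)
  have Bn: "(B ^ l) $ n =
      of_nat (r - 1) ^ n * pochhammer (of_nat l / of_nat (r - 1)) n * (u ^ (r - 1)) ^ n / fact n" for l
    unfolding B_def g_def by (rule inverse_fps_gpower_power_nth)
  have pw: "((B - 1) ^ k) $ n = fact k * \<gamma> r n k * (u ^ (r - 1)) ^ n / fact n" for k
  proof -
    have "(B - 1) ^ k = (\<Sum>l\<le>k. of_nat (k choose l) * B ^ l * (- 1) ^ (k - l))"
      using binomial_ring[of B "- 1" k] by simp
    also have "\<dots> = (\<Sum>l\<le>k. fps_const ((- 1) ^ (k - l) * of_nat (k choose l)) * B ^ l)"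
      by (intro sum.cong refl) (simp flip: fps_const_mult fps_const_power fps_const_neg fps_of_nat add: mult_ac)
    finally have pw_sum: "((B - 1) ^ k) $ n = (\<Sum>l\<le>k. (- 1) ^ (k - l) * of_nat (k choose l) * (B ^ l) $ n)"
      by (simp add: fps_sum_nth)
    show ?thesis
      by (simp add: pw_sum Bn gamma_eq_pochhammer[OF assms] sum_distrib_left sum_distrib_right sum_divide_distrib mult_ac)
  qed
  have "(fps_exp 1 oo (fps_const (u * v) / g - fps_const (u * v))) $ n =
      (\<Sum>k=0..n. 1 / fact k * ((u * v) ^ k * ((B - 1) ^ k) $ n))"
    unfolding H fps_compose_nth power_mult_distrib fps_const_power fps_mult_left_const_nth by simp
  also have "\<dots> = diagram_egf r u v $ n"
    by (simp add: pw diagram_egf_nth[OF assms] sum_distrib_left sum_distrib_right sum_divide_distrib atLeast0AtMost mult_ac)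
  finally show "diagram_egf r u v $ n = (fps_exp 1 oo
         (fps_const (u * v) /
            fps_gpower (1 - fps_const (of_nat (r - 1) * u ^ (r - 1)) * fps_X) (1 / of_nat (r - 1))
          - fps_const (u * v))) $ n"
    by (simp add: g_def)
qed
section \<open>Congruence modulo the Weyl relation\<close>

lemma weyl_ideal_plus:
  assumes "g \<in> weyl_ideal" "f \<in> weyl_ideal"
  shows "f + g \<in> weyl_ideal"
  using assms(1) by induction (simp_all add: assms(2) weyl_ideal.add flip: add.assoc)

lemma weyl_ideal_mult:
  assumes "f \<in> weyl_ideal"
  shows "a * f * b \<in> weyl_ideal"
  using assms
proof induction
  case zero
  show ?case by (simp add: weyl_ideal.zero)
next
  case (add f p q)
  have "a * (f + p * (D_gen * X_gen - X_gen * D_gen - 1) * q) * b =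
    a * f * b + (a * p) * (D_gen * X_gen - X_gen * D_gen - 1) * (q * b)"
    by (simp only: distrib_left distrib_right mult.assoc)
  then show ?case using weyl_ideal.add[OF add.IH] by simp
qed

lemma weyl_ideal_mult_left: "f \<in> weyl_ideal \<Longrightarrow> a * f \<in> weyl_ideal"
  using weyl_ideal_mult[of f a 1] by simp

lemma weyl_ideal_uminus: "f \<in> weyl_ideal \<Longrightarrow> - f \<in> weyl_ideal"
  using weyl_ideal_mult_left[of f "- 1"] by simp

definition weyl_eq :: "'k::field_char_0 free_algebra \<Rightarrow> 'k free_algebra \<Rightarrow> bool" (infix "\<approx>" 50) where
  "f \<approx> g \<longleftrightarrow> f - g \<in> weyl_ideal"

lemma weyl_eq_refl [simp, intro]: "f \<approx> f"
  by (simp add: weyl_eq_def weyl_ideal.zero)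

lemma weyl_eq_sym: "f \<approx> g \<Longrightarrow> g \<approx> f"
  unfolding weyl_eq_def by (metis minus_diff_eq weyl_ideal_uminus)

lemma weyl_eq_trans [trans]: "f \<approx> g \<Longrightarrow> g \<approx> h \<Longrightarrow> f \<approx> h"
  unfolding weyl_eq_def using weyl_ideal_plus[of "g - h" "f - g"] by simp

lemma weyl_eq_add: "f \<approx> g \<Longrightarrow> f' \<approx> g' \<Longrightarrow> f + f' \<approx> g + g'"
  unfolding weyl_eq_def using weyl_ideal_plus[of "f' - g'" "f - g"] by (simp add: algebra_simps)

lemma weyl_eq_sum: "(\<And>k. k \<in> A \<Longrightarrow> f k \<approx> g k) \<Longrightarrow> sum f A \<approx> sum g A"
  by (induction A rule: infinite_finite_induct) (auto intro: weyl_eq_add)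

lemma weyl_eq_mult: "f \<approx> g \<Longrightarrow> a * f * b \<approx> a * g * b"
  unfolding weyl_eq_def using weyl_ideal_mult[of "f - g" a b] by (simp add: algebra_simps)

lemma weyl_eq_mult_left: "f \<approx> g \<Longrightarrow> a * f \<approx> a * g"
  using weyl_eq_mult[of f g a 1] by simp

lemma weyl_eq_mult_right: "f \<approx> g \<Longrightarrow> f * b \<approx> g * b"
  using weyl_eq_mult[of f g 1 b] by simp

lemma D_X_weyl_eq: "D_gen * X_gen \<approx> X_gen * D_gen + 1"
  using weyl_ideal.add[OF weyl_ideal.zero, of 1 1] by (simp add: weyl_eq_def diff_diff_eq)

text \<open>Moving \<open>D\<close> to the right through \<open>X\<^sup>m\<close>, each of the \<open>m\<close> factors \<open>X\<close> can absorb it once. This is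
  the algebraic counterpart of the choice of an output for the input slot of a new node.\<close>

lemma D_X_power_weyl_eq:
  "D_gen * X_gen ^ m \<approx>
    (X_gen ^ m * D_gen + of_nat m * X_gen ^ (m - 1) :: 'k::field_char_0 free_algebra)"
proof (induction m)
  case 0
  show ?case by simp
next
  case (Suc m)
  have X: "X_gen * (of_nat m * X_gen ^ (m - 1)) = (of_nat m * X_gen ^ m :: 'k free_algebra)"
  proof (cases m)
    case (Suc j)
    have "X_gen * (of_nat m * X_gen ^ j) = (X_gen * of_nat m) * (X_gen ^ j :: 'k free_algebra)"
      by (rule mult.assoc[symmetric])
    also have "\<dots> = of_nat m * X_gen ^ m"
      unfolding mult_of_nat_commute[symmetric] by (simp add: Suc mult.assoc)
    finally show ?thesis by (simp add: Suc)
  qed simp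
  have "(D_gen * X_gen) * X_gen ^ m \<approx> ((X_gen * D_gen + 1) * X_gen ^ m :: 'k free_algebra)"
    by (rule weyl_eq_mult_right[OF D_X_weyl_eq])
  also have "\<dots> = X_gen * (D_gen * X_gen ^ m) + X_gen ^ m"
    by (simp add: distrib_right mult.assoc)
  also have "\<dots> \<approx> X_gen * (X_gen ^ m * D_gen + of_nat m * X_gen ^ (m - 1)) + X_gen ^ m"
    by (rule weyl_eq_add[OF weyl_eq_mult_left[OF Suc.IH] weyl_eq_refl])
  also have "\<dots> = X_gen ^ Suc m * D_gen + of_nat (Suc m) * X_gen ^ (Suc m - 1)"
    using X by (simp add: distrib_left distrib_right add.assoc add.commute mult.assoc)
  finally show ?case by (simp only: mult.assoc power_Suc)
qed

lemma scalar_0: "scalar 0 = 0" and scalar_1: "scalar 1 = 1"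
  and scalar_of_nat: "scalar (of_nat n) = of_nat n"
  by (simp_all add: scalar_def)

lemma scalar_add: "scalar (a + b) = scalar a + scalar b"
  by (simp add: scalar_def single_add)

lemma scalar_mult: "scalar (a * b) = scalar a * scalar b"
  by (simp add: scalar_def mult_single)

lemma mult_scalar_single: "Poly_Mapping.single w d * scalar c = scalar c * Poly_Mapping.single w d"
  by (simp add: scalar_def mult_single mult.commute)

lemma X_gen_power: "X_gen ^ a = Poly_Mapping.single (Word (replicate a X_letter)) 1"
proof (induction a)
  case 0
  show ?case by (simp flip: zero_word_def)
next
  case (Suc a)
  then show ?case by (simp add: X_gen_def mult_single)
qed

lemma D_gen_power: "D_gen ^ a = Poly_Mapping.single (Word (replicate a D_letter)) 1"
proof (induction a)
  case 0
  show ?case by (simp flip: zero_word_def)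
next
  case (Suc a)
  then show ?case by (simp add: D_gen_def mult_single)
qed

lemma normal_monomial:
  "scalar c * X_gen ^ a * D_gen ^ b =
    Poly_Mapping.single (Word (replicate a X_letter @ replicate b D_letter)) c"
proof -
  have "scalar c = Poly_Mapping.single (Word []) c" by (simp add: scalar_def zero_word_def)
  then show ?thesis by (simp add: X_gen_power D_gen_power mult_single)
qed

text \<open>Normal ordering of one more factor \<open>X\<^sup>rD\<close>. The two terms are the two terms of the recurrence
  for \<open>\<gamma>\<close>, which is why the exponent is kept in the form \<open>k + (r - 1) n\<close>.\<close>

lemma normal_monomial_step:
  assumes "r \<ge> 1"
  shows "X_gen ^ r * D_gen * (scalar c * X_gen ^ (k + (r - 1) * n) * D_gen ^ k) \<approx>
    scalar c * X_gen ^ (Suc k + (r - 1) * Suc n) * D_gen ^ Suc k +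
    scalar (of_nat (k + (r - 1) * n) * c) * X_gen ^ (k + (r - 1) * Suc n) * D_gen ^ k"
proof -
  define m where "m = k + (r - 1) * n"
  \<comment> \<open>For \<open>m = 0\<close> the truncated exponent \<open>m - 1\<close> is harmless: its term has coefficient 0.\<close>
  have r: "r + m = Suc k + (r - 1) * Suc n" "m > 0 \<Longrightarrow> r + (m - 1) = k + (r - 1) * Suc n"
    using assms by (cases r; simp add: m_def algebra_simps)+
  have X_scalar: "X_gen ^ a * (scalar c * f) = scalar c * (X_gen ^ a * f)" for a f and c :: 'a
    unfolding X_gen_power mult.assoc[symmetric] mult_scalar_single ..
  have D_scalar: "D_gen * (scalar c * f) = scalar c * (D_gen * f)" for f
    unfolding D_gen_def mult.assoc[symmetric] mult_scalar_single ..
  have "X_gen ^ r * D_gen * (scalar c * X_gen ^ m * D_gen ^ k) =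
      scalar c * X_gen ^ r * (D_gen * X_gen ^ m) * D_gen ^ k"
    by (simp only: mult.assoc X_scalar D_scalar)
  also have "\<dots> \<approx> scalar c * X_gen ^ r * (X_gen ^ m * D_gen + of_nat m * X_gen ^ (m - 1)) * D_gen ^ k"
    by (rule weyl_eq_mult[OF D_X_power_weyl_eq])
  also have "\<dots> = scalar c * X_gen ^ (r + m) * D_gen ^ Suc k +
      scalar (of_nat m * c) * X_gen ^ (r + (m - 1)) * D_gen ^ k"
  proof -
    have "scalar c * X_gen ^ r * (of_nat m * X_gen ^ (m - 1)) * D_gen ^ k =
        scalar (of_nat m * c) * X_gen ^ (r + (m - 1)) * D_gen ^ k"
      unfolding scalar_of_nat[symmetric] mult.commute[of "of_nat m" c] scalar_mult power_add
      by (simp only: mult.assoc X_scalar)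
    then show ?thesis
      by (simp add: distrib_left distrib_right power_add mult.assoc)
  qed
  also have "\<dots> = scalar c * X_gen ^ (Suc k + (r - 1) * Suc n) * D_gen ^ Suc k +
      scalar (of_nat m * c) * X_gen ^ (k + (r - 1) * Suc n) * D_gen ^ k"
    unfolding r(1) using r(2) by (cases "m = 0") (simp_all only: of_nat_0 mult_zero_left scalar_0 not_gr_zero)
  finally show ?thesis unfolding m_def .
qed

section \<open>Uniqueness of normal forms\<close>

text \<open>The Weyl algebra acts on polynomials: \<open>X\<close> multiplies by the indeterminate and \<open>D\<close>
  differentiates. This action detects whether a normally ordered element vanishes.\<close>

fun letter_action :: "letter \<Rightarrow> 'k::field_char_0 poly \<Rightarrow> 'k poly" where
  "letter_action X_letter p = pCons 0 p"
| "letter_action D_letter p = pderiv p"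

fun word_action :: "word \<Rightarrow> 'k::field_char_0 poly \<Rightarrow> 'k poly" where
  "word_action (Word ls) p = foldr letter_action ls p"

definition weyl_action :: "'k::field_char_0 free_algebra \<Rightarrow> 'k poly \<Rightarrow> 'k poly" where
  "weyl_action f p = (\<Sum>w\<in>Poly_Mapping.keys f. smult (Poly_Mapping.lookup f w) (word_action w p))"

lemma word_action_plus: "word_action (v + w) p = word_action v (word_action w p)"
  by (cases v; cases w) simp

lemma word_action_add: "word_action w (p + q) = word_action w p + word_action w q"
proof (cases w)
  case (Word ls)
  have la: "letter_action l (p + q) = letter_action l p + letter_action l q" for l and p q :: "'a poly"
    by (cases l) (simp_all add: pderiv_add)
  show ?thesis unfolding Word by (induction ls) (simp_all add: la)
qed

lemma word_action_smult: "word_action w (smult c p) = smult c (word_action w p)"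
proof (cases w)
  case (Word ls)
  have la: "letter_action l (smult c p) = smult c (letter_action l p)" for l and p :: "'a poly"
    by (cases l) (simp_all add: pderiv_smult)
  show ?thesis unfolding Word by (induction ls) (simp_all add: la)
qed

lemma weyl_action_superset:
  assumes "finite A" "Poly_Mapping.keys f \<subseteq> A"
  shows "weyl_action f p = (\<Sum>w\<in>A. smult (Poly_Mapping.lookup f w) (word_action w p))"
  unfolding weyl_action_def
  using assms by (intro sum.mono_neutral_left) (auto simp: in_keys_iff)

lemma weyl_action_add: "weyl_action (f + g) p = weyl_action f p + weyl_action g p"
proof -
  define A where "A = Poly_Mapping.keys f \<union> Poly_Mapping.keys g"
  have "finite A" "Poly_Mapping.keys f \<subseteq> A" "Poly_Mapping.keys g \<subseteq> A" "Poly_Mapping.keys (f + g) \<subseteq> A"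
    using keys_add[of f g] by (auto simp: A_def)
  then show ?thesis
    by (simp add: weyl_action_superset[of A] lookup_add smult_add_left sum.distrib)
qed

lemma weyl_action_single: "weyl_action (Poly_Mapping.single w c) p = smult c (word_action w p)"
  by (simp add: weyl_action_def)

lemma weyl_action_0: "weyl_action 0 p = 0"
  by (simp add: weyl_action_def)

lemma weyl_action_minus: "weyl_action (f - g) p = weyl_action f p - weyl_action g p"
  using weyl_action_add[of "f - g" g p] by simp

lemma weyl_action_arg_add: "weyl_action f (p + q) = weyl_action f p + weyl_action f q"
  by (simp add: weyl_action_def word_action_add smult_add_right sum.distrib)

lemma weyl_action_arg_0: "weyl_action f 0 = 0"
  using weyl_action_arg_add[of f 0 0] by simp

lemma poly_mapping_single_add_induct [case_names single add]:
  fixes f :: "'a \<Rightarrow>\<^sub>0 'b::comm_monoid_add"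
  assumes single: "\<And>w c. P (Poly_Mapping.single w c)"
    and add: "\<And>f g. P f \<Longrightarrow> P g \<Longrightarrow> P (f + g)"
  shows "P f"
proof (induction f rule: update_induct)
  case const
  show ?case using single[of undefined 0] by simp
next
  case (update f a b)
  have "Poly_Mapping.update a b f = f + Poly_Mapping.single a b"
    using update by (intro poly_mapping_eqI)
      (auto simp: lookup_update lookup_add lookup_single in_keys_iff when_def)
  then show ?case using add single update by simp
qed

lemma weyl_action_mult: "weyl_action (f * g) p = weyl_action f (weyl_action g p)"
proof (induction f rule: poly_mapping_single_add_induct)
  case (single v c)
  show ?case
  proof (induction g rule: poly_mapping_single_add_induct)
    case (single w d)
    show ?case
      by (simp add: mult_single weyl_action_single word_action_plus word_action_smult)
  next
    case (add g h)
    then show ?case by (simp add: distrib_left weyl_action_add weyl_action_arg_add)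
  qed
next
  case (add f h)
  then show ?case by (simp add: distrib_right weyl_action_add)
qed

lemma weyl_action_X: "weyl_action X_gen p = pCons 0 p"
  and weyl_action_D: "weyl_action D_gen p = pderiv p"
  and weyl_action_1: "weyl_action 1 p = p"
  by (simp_all add: X_gen_def D_gen_def weyl_action_single zero_word_def flip: single_one)

text \<open>The product rule: \<open>(x p)' - x p' = p\<close>, so the generator of the ideal acts as 0.\<close>

lemma weyl_action_ideal:
  assumes "f \<in> weyl_ideal"
  shows "weyl_action f p = 0"
  using assms
  by induction (simp_all add: weyl_action_0 weyl_action_add weyl_action_minus weyl_action_mult
      weyl_action_X weyl_action_D weyl_action_1 weyl_action_arg_0 pderiv_pCons)

lemma funpow_pderiv_monom: "(pderiv ^^ b) (monom c b) = [:fact b * c:]"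
  by (induction b arbitrary: c)
    (simp_all add: funpow_swap1 pderiv_monom monom_0 mult_ac del: funpow.simps(2) add: funpow_Suc_right)

lemma funpow_pderiv_monom_eq_0: "m < b \<Longrightarrow> (pderiv ^^ b) (monom c m) = 0"
proof (induction b arbitrary: m c)
  case (Suc b)
  show ?case
  proof (cases m)
    case 0
    have "(pderiv ^^ b) (0 :: 'a poly) = 0" by (induction b) simp_all
    then show ?thesis using 0 by (simp add: pderiv_monom monom_0 funpow_Suc_right del: funpow.simps(2))
  next
    case (Suc m')
    then show ?thesis using Suc.IH[of m'] Suc.prems
      by (simp add: pderiv_monom funpow_Suc_right del: funpow.simps(2))
  qed
qed simp

lemma word_action_normal:
  "word_action (Word (replicate a X_letter @ replicate b D_letter)) p =
    monom 1 a * (pderiv ^^ b) p"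
proof -
  have X: "foldr letter_action (replicate a X_letter) q = monom 1 a * q" for q :: "'a poly"
    by (induction a) (simp_all add: monom_0 monom_Suc flip: one_pCons)
  have D: "foldr letter_action (replicate b D_letter) p = (pderiv ^^ b) p"
    by (induction b) simp_all
  show ?thesis by (simp only: word_action.simps foldr_append comp_def X D)
qed

text \<open>Among the monomials \<open>X\<^sup>a D\<^sup>b\<close> that occur, take one with the smallest \<open>b\<close> and apply the element
  to \<open>x\<^sup>b\<close>. Monomials with a higher power of \<open>D\<close> annihilate \<open>x\<^sup>b\<close>, and \<open>X\<^sup>a D\<^sup>b\<close> sends it to \<open>b! x\<^sup>a\<close>, so
  the coefficients can be read off. Characteristic 0 enters through \<open>b! \<noteq> 0\<close>.\<close>

lemma normally_ordered_action_0:
  fixes g :: "'k::field_char_0 free_algebra"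
  assumes g: "normally_ordered g" and action: "\<And>p. weyl_action g p = 0"
  shows "g = 0"
proof (rule ccontr)
  assume "g \<noteq> 0"
  define W where "W a b = Word (replicate a X_letter @ replicate b D_letter)" for a b
  have W_eq: "W a b = W a' b' \<longleftrightarrow> a = a' \<and> b = b'" for a b a' b'
  proof
    assume "W a b = W a' b'"
    then have eq: "replicate a X_letter @ replicate b D_letter =
        replicate a' X_letter @ replicate b' D_letter"
      by (simp add: W_def)
    show "a = a' \<and> b = b'"
      using arg_cong[OF eq, of "\<lambda>l. length (filter ((=) X_letter) l)"]
        arg_cong[OF eq, of "\<lambda>l. length (filter ((=) D_letter) l)"]
      by simp
  qed simp
  have keys: "\<exists>a b. w = W a b" if "w \<in> Poly_Mapping.keys g" for w
    using g that by (simp add: normally_ordered_def W_def)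
  obtain w where "w \<in> Poly_Mapping.keys g" using \<open>g \<noteq> 0\<close> by fastforce
  then have ex: "\<exists>b a. W a b \<in> Poly_Mapping.keys g" using keys by metis
  define b where "b = (LEAST b. \<exists>a. W a b \<in> Poly_Mapping.keys g)"
  obtain a where a: "W a b \<in> Poly_Mapping.keys g"
    using LeastI_ex[OF ex] unfolding b_def by blast
  have least: "b \<le> b'" if "W a' b' \<in> Poly_Mapping.keys g" for a' b'
    unfolding b_def using that by (intro Least_le) blast
  have coeff: "coeff (word_action w (monom 1 b)) a = (if w = W a b then fact b else 0 :: 'k)"
    if "w \<in> Poly_Mapping.keys g" for w
  proof -
    obtain a' b' where w: "w = W a' b'" using keys[OF \<open>w \<in> Poly_Mapping.keys g\<close>] by blast
    have act: "word_action (W a b) p = monom 1 a * (pderiv ^^ b) p" for a b and p :: "'k poly"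
      unfolding W_def by (rule word_action_normal)
    have "b \<le> b'" using least that w by blast
    then consider "b' = b" | "b < b'" by linarith
    then show ?thesis
    proof cases
      case 1
      then show ?thesis
        by (simp add: w act W_eq funpow_pderiv_monom mult.commute[of "monom 1 a'"] smult_monom)
    next
      case 2
      then show ?thesis by (simp add: w act W_eq funpow_pderiv_monom_eq_0)
    qed
  qed
  have "0 = coeff (weyl_action g (monom 1 b)) a" by (simp add: action)
  also have "\<dots> = (\<Sum>w\<in>Poly_Mapping.keys g.
      Poly_Mapping.lookup g w * coeff (word_action w (monom 1 b)) a)"
    by (simp add: weyl_action_def coeff_sum)
  also have "\<dots> = (\<Sum>w\<in>Poly_Mapping.keys g.
      if w = W a b then Poly_Mapping.lookup g w * fact b else 0)"
    by (rule sum.cong) (simp_all add: coeff)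
  also have "\<dots> = Poly_Mapping.lookup g (W a b) * fact b"
    using a by (subst sum.delta) auto
  finally show False using a by (simp add: in_keys_iff)
qed

lemma normal_form_eqI:
  assumes "normally_ordered g" "f \<approx> g"
  shows "normal_form f = g"
  unfolding normal_form_def
proof (rule the_equality)
  show "normally_ordered g \<and> f - g \<in> weyl_ideal"
    using assms by (simp add: weyl_eq_def)
next
  fix h assume h: "normally_ordered h \<and> f - h \<in> weyl_ideal"
  then have "f \<approx> h" by (simp add: weyl_eq_def)
  then have "h \<approx> g" by (rule weyl_eq_trans[OF weyl_eq_sym assms(2)])
  moreover have "normally_ordered (h - g)"
    using h assms(1) keys_diff[of h g] unfolding normally_ordered_def by blast
  ultimately have "h - g = 0"
    by (intro normally_ordered_action_0) (simp_all add: weyl_eq_def weyl_action_ideal)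
  then show "h = g" by simp
qed

lemma normally_ordered_sum:
  "normally_ordered (\<Sum>k\<in>A. scalar (c k) * X_gen ^ a k * D_gen ^ b k)"
  unfolding normally_ordered_def
proof
  fix w assume "w \<in> Poly_Mapping.keys (\<Sum>k\<in>A. scalar (c k) * X_gen ^ a k * D_gen ^ b k)"
  then obtain k where "w \<in> Poly_Mapping.keys (scalar (c k) * X_gen ^ a k * D_gen ^ b k)"
    by (blast dest: subsetD[OF keys_sum])
  then show "\<exists>a b. w = Word (replicate a X_letter @ replicate b D_letter)"
    by (auto simp: normal_monomial split: if_splits)
qed

section \<open>Powers of the operator and the generating function\<close>

lemma power_weyl_eq:
  assumes "r \<ge> 2"
  shows "(X_gen ^ r * D_gen) ^ n \<approx>
    (\<Sum>k\<le>n. scalar (\<gamma> r n k) * X_gen ^ (k + (r - 1) * n) * D_gen ^ k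
      :: 'k::field_char_0 free_algebra)"
proof (induction n)
  case 0
  show ?case using assms by (simp add: gamma_0 scalar_1)
next
  case (Suc n)
  define M :: "nat \<Rightarrow> 'k \<Rightarrow> 'k free_algebra"
    where "M k c = scalar c * X_gen ^ (k + (r - 1) * Suc n) * D_gen ^ k" for k c
  have M_add: "M k (c + d) = M k c + M k d" and M_0: "M k 0 = 0" for k c d
    by (simp_all add: M_def scalar_add scalar_0 distrib_right)
  have "(X_gen ^ r * D_gen) ^ Suc n \<approx> X_gen ^ r * D_gen *
      (\<Sum>k\<le>n. scalar (\<gamma> r n k) * X_gen ^ (k + (r - 1) * n) * D_gen ^ k :: 'k free_algebra)"
    unfolding power_Suc by (rule weyl_eq_mult_left[OF Suc.IH])
  also have "\<dots> = (\<Sum>k\<le>n. X_gen ^ r * D_gen *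
      (scalar (\<gamma> r n k) * X_gen ^ (k + (r - 1) * n) * D_gen ^ k))"
    by (rule sum_distrib_left)
  also have "\<dots> \<approx> (\<Sum>k\<le>n. M (Suc k) (\<gamma> r n k) + M k (of_nat (k + (r - 1) * n) * \<gamma> r n k))"
    unfolding M_def using assms by (intro weyl_eq_sum normal_monomial_step) simp
  also have "\<dots> = (\<Sum>k\<le>Suc n. M k (if k = 0 then 0 else \<gamma> r n (k - 1))) +
      (\<Sum>k\<le>Suc n. M k (of_nat (k + (r - 1) * n) * \<gamma> r n k))"
  proof -
    have "(\<Sum>k\<le>Suc n. M k (if k = 0 then 0 else \<gamma> r n (k - 1))) = (\<Sum>k\<le>n. M (Suc k) (\<gamma> r n k))"
      by (subst sum.atMost_Suc_shift) (simp add: M_0)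
    moreover have "(\<Sum>k\<le>Suc n. M k (of_nat (k + (r - 1) * n) * \<gamma> r n k)) =
        (\<Sum>k\<le>n. M k (of_nat (k + (r - 1) * n) * \<gamma> r n k))"
      using gamma_eq_0[OF assms, of n "Suc n", where 'k = 'k] by (simp add: M_0)
    ultimately show ?thesis by (simp only: sum.distrib)
  qed
  also have "\<dots> = (\<Sum>k\<le>Suc n. M k (\<gamma> r (Suc n) k))"
    unfolding gamma_Suc[OF assms] M_add sum.distrib ..
  finally show ?case unfolding M_def .
qed

lemma normal_form_power:
  assumes "r \<ge> 2"
  shows "normal_form ((X_gen ^ r * D_gen) ^ n :: 'k::field_char_0 free_algebra) =
    (\<Sum>k\<le>n. scalar (\<gamma> r n k) * X_gen ^ (k + (r - 1) * n) * D_gen ^ k)"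
  by (rule normal_form_eqI[OF normally_ordered_sum power_weyl_eq[OF assms]])

theorem proposition10:
  fixes r :: nat and u v :: "'k::field_char_0"
  assumes "r \<ge> 2"
  shows
    "diagram_egf r u v =
       (fps_exp 1 oo
         (fps_const (u * v) /
            fps_gpower (1 - fps_const (of_nat (r - 1) * u ^ (r - 1)) * fps_X) (1 / of_nat (r - 1))
          - fps_const (u * v))) \<and>
     (r = 2 \<longrightarrow> (\<forall>n\<ge>1.
       normal_form ((X_gen ^ 2 * D_gen) ^ n :: 'k free_algebra) =
         (\<Sum>k=1..n. scalar (of_nat ((n - 1) choose (k - 1)) * (fact n / fact k))
                     * X_gen ^ (n + k) * D_gen ^ k))) \<and>
     (r \<ge> 3 \<longrightarrow> (\<forall>n.
       finite {k. \<gamma> r n k \<noteq> (0 :: 'k)} \<and>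
       normal_form ((X_gen ^ r * D_gen) ^ n :: 'k free_algebra) =
         (\<Sum>k | \<gamma> r n k \<noteq> (0 :: 'k). scalar (\<gamma> r n k) * X_gen ^ (k + (r - 1) * n) * D_gen ^ k)))"
proof (intro conjI impI allI)
  show "diagram_egf r u v =
       (fps_exp 1 oo
         (fps_const (u * v) /
            fps_gpower (1 - fps_const (of_nat (r - 1) * u ^ (r - 1)) * fps_X) (1 / of_nat (r - 1))
          - fps_const (u * v)))"
    by (rule diagram_egf_eq_exp[OF assms])
next
  fix n :: nat
  assume r: "r = 2" and n: "n \<ge> 1"
  have "normal_form ((X_gen ^ 2 * D_gen) ^ n :: 'k free_algebra) =
      (\<Sum>k\<le>n. scalar (\<gamma> 2 n k) * X_gen ^ (n + k) * D_gen ^ k)"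
    using normal_form_power[of 2 n, where 'k = 'k] by (simp add: add.commute)
  also have "\<dots> = (\<Sum>k=1..n. scalar (\<gamma> 2 n k) * X_gen ^ (n + k) * D_gen ^ k)"
  proof (rule sum.mono_neutral_right)
    show "\<forall>k\<in>{..n} - {1..n}. scalar (\<gamma> 2 n k) * X_gen ^ (n + k) * D_gen ^ k = (0 :: 'k free_algebra)"
    proof
      fix k assume "k \<in> {..n} - {1..n}"
      then have "k = 0" by auto
      then show "scalar (\<gamma> 2 n k) * X_gen ^ (n + k) * D_gen ^ k = (0 :: 'k free_algebra)"
        using n by (simp add: gamma_2 scalar_0)
    qed
  qed auto
  also have "\<dots> = (\<Sum>k=1..n. scalar (of_nat ((n - 1) choose (k - 1)) * (fact n / fact k))
      * X_gen ^ (n + k) * D_gen ^ k)"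
    by (rule sum.cong) (simp_all add: gamma_2[OF n])
  finally show "normal_form ((X_gen ^ 2 * D_gen) ^ n :: 'k free_algebra) =
         (\<Sum>k=1..n. scalar (of_nat ((n - 1) choose (k - 1)) * (fact n / fact k))
                     * X_gen ^ (n + k) * D_gen ^ k)" .
next
  fix n :: nat
  have sub: "{k. \<gamma> r n k \<noteq> (0 :: 'k)} \<subseteq> {..n}"
    using gamma_eq_0[OF assms, where 'k = 'k] by (auto simp flip: not_less)
  then show "finite {k. \<gamma> r n k \<noteq> (0 :: 'k)}"
    by (rule finite_subset) simp
  show "normal_form ((X_gen ^ r * D_gen) ^ n :: 'k free_algebra) =
         (\<Sum>k | \<gamma> r n k \<noteq> (0 :: 'k). scalar (\<gamma> r n k) * X_gen ^ (k + (r - 1) * n) * D_gen ^ k)"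
    unfolding normal_form_power[OF assms]
    using sub by (intro sum.mono_neutral_right) (auto simp: scalar_0)
qed

end
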